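(* Fix $p \in (0,1)$. Let $A(p)$ be the random set of Fibonacci numbers defined in the context below. Let $S \subset \{F_i\}_{i=1}^{\infty}$ have asymptotic density $q(S)$ in the Fibonacci numbers. Then, with probability $1$, $S \cap A(p)$ has asymptotic density $q(S)$ in $A(p)$, that is, $$\lim_{n\to\infty} \frac{\#(A_n(p) \cap S)}{\#A_n(p)} = q(S).$$
   Context: The Fibonacci numbers are normalized as $F_1 = 1$, $F_2 = 2$, $F_{n+1} = F_n + F_{n-1}$. For $S \subset \{F_i\}$ put $q(S,n) = \#\{ i : 1 \le i \le n,\ F_i \in S\}/n$. The asymptotic density is $q(S) = \lim_{n\to\infty} q(S,n)$, and the hypothesis is that this limit exists. The random sets are built recursively. Let $A_0(p) = \emptyset$. For $n \ge 1$: - if $F_{n-1} \in A_{n-1}(p)$, then $A_n(p) = A_{n-1}(p)$; - otherwise, $A_n(p) = A_{n-1}(p) \cup \{F_n\}$ with probability $p$, and $A_n(p) = A_{n-1}(p)$ with probability $1-p$. The random choices at different steps are independent. For $n = 1$ there is no $F_0$, so $F_1 \in A_1(p)$ with probability $p$. Finally $A(p) = \bigcup_n A_n(p)$. Note that $A_n(p) = A(p) \cap \{F_1, \dots, F_n\}$. *)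

theory Defs
  imports "HOL-Probability.Probability" "HOL-Number_Theory.Fib"
begin

text \<open>
  The normalization is $F_1 = 1$, $F_2 = 2$, so the library sequence (with
  \<^term>\<open>fib 1 = fib 2\<close>) is shifted by one. The value at index \<open>0\<close> is not one of the $F_i$.
\<close>

definition F :: "nat \<Rightarrow> nat" where
  "F n = fib (Suc n)"

lemma F_1: "F 1 = 1" and F_2: "F 2 = 2" and F_rec: "n \<ge> 1 \<Longrightarrow> F (n + 1) = F n + F (n - 1)"
  by (cases n; simp add: F_def numeral_2_eq_2)+

definition fib_ratio :: "nat set \<Rightarrow> nat \<Rightarrow> real" where
  "fib_ratio S n = real (card {i. 1 \<le> i \<and> i \<le> n \<and> F i \<in> S}) / real n"

definition fib_density :: "nat set \<Rightarrow> real" where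
  "fib_density S = lim (fib_ratio S)"

text \<open>
  \<open>rand_fib c n\<close> is $A_n(p)$ for the outcome \<open>c\<close> of the random choices: \<open>c n\<close> says that the
  choice at step \<open>n\<close>, if it is used at all, is to add $F_n$. The probability \<open>p\<close> enters
  through the law of \<open>c\<close>. At step \<open>1\<close> the choice is always used, because \<open>rand_fib c 0\<close> is empty.
\<close>

primrec rand_fib :: "(nat \<Rightarrow> bool) \<Rightarrow> nat \<Rightarrow> nat set" where
  "rand_fib c 0 = {}"
| "rand_fib c (Suc n) =
     (if F n \<in> rand_fib c n then rand_fib c n
      else if c (Suc n) then rand_fib c n \<union> {F (Suc n)}
      else rand_fib c n)"

definition rand_fib_set :: "(nat \<Rightarrow> bool) \<Rightarrow> nat set" where
  "rand_fib_set c = (\<Union>n. rand_fib c n)"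

lemma F_strict_mono:
  assumes "1 \<le> i" "i < j"
  shows "F i < F j"
proof -
  have step: "F n < F (Suc n)" if "n \<ge> 1" for n
    using that fib_neq_0_nat[of n] by (simp add: F_def)
  show ?thesis using assms(2,1)
    by (induction i j rule: less_Suc_induct) (use step in auto)
qed

lemma rand_fib_subset: "rand_fib c n \<subseteq> F ` {1..n}"
proof (induction n)
  case (Suc n)
  have "F ` {1..n} \<subseteq> F ` {1..Suc n}" by (intro image_mono) auto
  moreover have "F (Suc n) \<in> F ` {1..Suc n}" by (intro imageI) auto
  ultimately show ?case using Suc by auto
qed simp

lemma rand_fib_mono: "m \<le> n \<Longrightarrow> rand_fib c m \<subseteq> rand_fib c n"
  by (rule lift_Suc_mono_le[of "rand_fib c"]) auto

lemma rand_fib_eq: "rand_fib c n = rand_fib_set c \<inter> F ` {1..n}"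
proof -
  have old: "x \<in> rand_fib c n" if "x \<in> rand_fib c (n + k)" "x \<in> F ` {1..n}" for x k
    using that
  proof (induction k)
    case (Suc k)
    have "x \<noteq> F (Suc (n + k))"
      using Suc.prems(2) F_strict_mono[of _ "Suc (n + k)"] by fastforce
    then show ?case using Suc by (auto split: if_splits)
  qed simp
  show ?thesis
  proof (intro equalityI subsetI)
    fix x assume "x \<in> rand_fib c n"
    then show "x \<in> rand_fib_set c \<inter> F ` {1..n}"
      using rand_fib_subset[of c n] by (auto simp: rand_fib_set_def)
  next
    fix x assume x: "x \<in> rand_fib_set c \<inter> F ` {1..n}"
    then obtain m where "x \<in> rand_fib c m" by (auto simp: rand_fib_set_def)
    then have "x \<in> rand_fib c (n + m)" using rand_fib_mono[of m "n + m" c] by auto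
    then show "x \<in> rand_fib c n" using old x by auto
  qed
qed

end

theory Submission
  imports Defs "HOL-Library.Discrete_Functions"
begin

text \<open>
  Let $Y_n$ be the indicator of $F_n \in A(p)$ and put $\pi = p/(1+p)$, the stationary probability
  of selection. The centred variables $Z_n = Y_n - \pi$ satisfy $Z_{n+1} = -p Z_n + D_n$, where $D_n$
  is orthogonal to every function of the first $n$ choices. Hence the correlations
  of the $Z_n$ decay geometrically, and a weighted sum $T_n = \sum_{i \le n} w_i Z_i$ with
  $|w_i| \le 1$ has second moment $O(n)$. Thus $\sum_k E (T_{k^2}/k^2)^2 < \infty$, which gives
  $T_{k^2}/k^2 \to 0$ almost surely, and $T_n/n \to 0$ follows since the increments of $T$ are
  bounded. Taking $w$ to be the indicator of $S$ and then $w = 1$, the numerator and the denominator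
  of the ratio, divided by $n$, tend to $\pi q(S)$ and $\pi$.
\<close>

section \<open>Two convergence criteria: limits along squares, and summable expectations\<close>

text \<open>Every \<open>n\<close> lies within \<open>2 * k\<close> above \<open>k^2\<close>, where
  \<open>k = floor_sqrt n\<close>. The unit bound on the increments keeps \<open>T\<close> within
  \<open>2 * k\<close> of its value at \<open>k^2\<close>, which is negligible against
  \<open>n\<close>.\<close>

lemma tendsto_0_of_squares:
  fixes T :: "nat \<Rightarrow> real"
  assumes incr: "\<And>n. \<bar>T (Suc n) - T n\<bar> \<le> 1"
    and sq: "(\<lambda>k. T (k\<^sup>2) / real (k\<^sup>2)) \<longlonglongrightarrow> 0"
  shows "(\<lambda>n. T n / real n) \<longlonglongrightarrow> 0"
proof -
  have lip: "\<bar>T (m + k) - T m\<bar> \<le> real k" for m k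
  proof (induction k)
    case (Suc k)
    then show ?case using incr[of "m + k"] by simp
  qed simp
  have sqrt_lim: "filterlim floor_sqrt at_top sequentially"
    unfolding filterlim_at_top
  proof
    fix m :: nat
    show "\<forall>\<^sub>F n in sequentially. m \<le> floor_sqrt n"
      using eventually_ge_at_top[of "m\<^sup>2"] by eventually_elim (simp add: le_floor_sqrt_iff)
  qed
  \<comment> \<open>The error term \<open>2 / real k\<close> is the drift \<open>2 * k\<close> since
    the last square, divided by \<open>k^2\<close>.\<close>
  define g where "g k = \<bar>T (k\<^sup>2) / real (k\<^sup>2)\<bar> + 2 / real k" for k
  have "g \<longlonglongrightarrow> \<bar>0\<bar> + 0"
    unfolding g_def
    by (intro tendsto_add tendsto_rabs sq lim_const_over_n)
  then have g_lim: "(\<lambda>n. g (floor_sqrt n)) \<longlonglongrightarrow> 0"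
    using filterlim_compose[OF _ sqrt_lim] by simp
  have "\<bar>T n / real n\<bar> \<le> g (floor_sqrt n)" if "n > 0" for n
  proof -
    define k where "k = floor_sqrt n"
    have "k > 0" and kn: "k\<^sup>2 \<le> n" and "n < (Suc k)\<^sup>2"
      using that Suc_floor_sqrt_power2_gt by (auto simp: k_def)
    \<comment> \<open>From \<open>n < (k + 1)^2 = k^2 + 2 * k + 1\<close>.\<close>
    then have "n - k\<^sup>2 \<le> 2 * k" by (simp add: power2_eq_square)
    moreover have "\<bar>T n - T (k\<^sup>2)\<bar> \<le> real (n - k\<^sup>2)"
      using lip[of "k\<^sup>2" "n - k\<^sup>2"] kn by simp
    ultimately have "\<bar>T n\<bar> \<le> \<bar>T (k\<^sup>2)\<bar> + 2 * real k" by linarith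
    then have "\<bar>T n\<bar> / real n \<le> (\<bar>T (k\<^sup>2)\<bar> + 2 * real k) / real n"
      by (intro divide_right_mono) auto
    also have "\<dots> \<le> (\<bar>T (k\<^sup>2)\<bar> + 2 * real k) / real (k\<^sup>2)"
      using kn \<open>k > 0\<close> that by (intro divide_left_mono mult_pos_pos)
        (auto simp del: of_nat_power)
    also have "\<dots> = g k"
      using \<open>k > 0\<close> by (simp add: g_def add_divide_distrib power2_eq_square)
    finally show ?thesis by (simp add: k_def)
  qed
  then have "\<forall>\<^sub>F n in sequentially. norm (T n / real n) \<le> g (floor_sqrt n)"
    by (intro eventually_sequentiallyI[of 1]) simp
  then show ?thesis
    using g_lim by (rule Lim_null_comparison)
qed

text \<open>Integral and sum may be exchanged for nonnegative terms, so the series of the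
  \<open>f n\<close> has finite integral. It is therefore finite almost everywhere, and the terms of
  a convergent series tend to 0.\<close>

lemma AE_tendsto_0_of_summable_integral:
  fixes f :: "nat \<Rightarrow> 'a \<Rightarrow> real"
  assumes int: "\<And>n. integrable M (f n)"
    and nonneg: "\<And>n x. 0 \<le> f n x"
    and sum: "summable (\<lambda>n. integral\<^sup>L M (f n))"
  shows "AE x in M. (\<lambda>n. f n x) \<longlonglongrightarrow> 0"
proof -
  have [measurable]: "f n \<in> borel_measurable M" for n
    using int by simp
  have "(\<integral>\<^sup>+x. (\<Sum>n. ennreal (f n x)) \<partial>M) = (\<Sum>n. \<integral>\<^sup>+x. ennreal (f n x) \<partial>M)"
    by (rule nn_integral_suminf) simp
  also have "\<dots> = (\<Sum>n. ennreal (integral\<^sup>L M (f n)))"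
    by (simp add: nn_integral_eq_integral int nonneg)
  also have "\<dots> = ennreal (\<Sum>n. integral\<^sup>L M (f n))"
    by (rule suminf_ennreal2) (simp_all add: sum nonneg)
  finally have "(\<integral>\<^sup>+x. (\<Sum>n. ennreal (f n x)) \<partial>M) \<noteq> \<infinity>"
    by simp
  then have "AE x in M. (\<Sum>n. ennreal (f n x)) \<noteq> \<infinity>"
    by (intro nn_integral_PInf_AE) simp_all
  then show ?thesis
  proof eventually_elim
    case (elim x)
    then have "summable (\<lambda>n. f n x)"
      by (intro summable_suminf_not_top) (simp_all add: nonneg)
    then show ?case by (rule summable_LIMSEQ_zero)
  qed
qed

section \<open>Selection indicators and their centred weighted sums, for a fixed outcome\<close>

text \<open>The indicator $Y_n$ as an arithmetic recursion in the choices, free of Fibonacci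
  numbers; \<open>sel_eq\<close> makes the link. The value 0 at index 0 lets the first choice always
  count.\<close>

primrec sel :: "(nat \<Rightarrow> bool) \<Rightarrow> nat \<Rightarrow> real" where
  "sel c 0 = 0"
| "sel c (Suc n) = of_bool (c (Suc n)) * (1 - sel c n)"

text \<open>The constant solves \<open>x = p * (1 - x)\<close>, the equation for a mean preserved by
  the recursion of \<open>sel\<close>.\<close>

definition dev :: "real \<Rightarrow> (nat \<Rightarrow> bool) \<Rightarrow> nat \<Rightarrow> real" where
  "dev p c n = sel c n - p / (1 + p)"

definition wdev :: "(nat \<Rightarrow> real) \<Rightarrow> real \<Rightarrow> (nat \<Rightarrow> bool) \<Rightarrow> nat \<Rightarrow> real" where
  "wdev w p c n = (\<Sum>i=1..n. w i * dev p c i)"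

lemma wdev_0 [simp]: "wdev w p c 0 = 0"
  by (simp add: wdev_def)

lemma wdev_Suc: "wdev w p c (Suc n) = wdev w p c n + w (Suc n) * dev p c (Suc n)"
  by (simp add: wdev_def)

lemma sel_01: "sel c n = 0 \<or> sel c n = 1"
  by (induction n) auto

lemma F_Suc_notin_rand_fib: "F (Suc n) \<notin> rand_fib c n"
proof
  assume "F (Suc n) \<in> rand_fib c n"
  then have "F (Suc n) \<in> F ` {1..n}"
    using rand_fib_subset[of c n] by blast
  then obtain i where "1 \<le> i" "i < Suc n" "F i = F (Suc n)"
    by fastforce
  then show False using F_strict_mono[of i "Suc n"] by simp
qed

lemma sel_eq: "sel c n = of_bool (F n \<in> rand_fib c n)"
  by (induction n) (auto simp: F_Suc_notin_rand_fib)

lemma finite_rand_fib [simp]: "finite (rand_fib c n)"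
  by (induction n) auto

lemma card_rand_fib_Int:
  "real (card (rand_fib c n \<inter> S)) = (\<Sum>i=1..n. of_bool (F i \<in> S) * sel c i)"
proof (induction n)
  case (Suc n)
  then show ?case
    by (auto simp: sel_eq F_Suc_notin_rand_fib)
qed simp

lemma fib_ratio_eq: "fib_ratio S n = (\<Sum>i=1..n. of_bool (F i \<in> S)) / real n"
proof -
  have "{i. 1 \<le> i \<and> i \<le> n \<and> F i \<in> S} = {1..n} \<inter> {i. F i \<in> S}"
    by auto
  then show ?thesis by (simp add: fib_ratio_def)
qed

text \<open>Substituting $Y_i = Z_i + p/(1+p)$ in the count separates a fluctuation from the
  deterministic ratio. The identity holds outcome by outcome, so only the fluctuation calls for
  probability.\<close>

lemma card_rand_fib_Int_div:
  "real (card (rand_fib c n \<inter> S)) / real n =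
     wdev (\<lambda>i. of_bool (F i \<in> S)) p c n / real n + p / (1 + p) * fib_ratio S n"
proof -
  have "(\<Sum>i=1..n. of_bool (F i \<in> S) * sel c i) = wdev (\<lambda>i. of_bool (F i \<in> S)) p c n
      + p / (1 + p) * (\<Sum>i=1..n. of_bool (F i \<in> S))"
    unfolding wdev_def dev_def sum_distrib_left sum.distrib[symmetric]
    by (intro sum.cong refl) (simp add: algebra_simps)
  then show ?thesis
    by (simp only: card_rand_fib_Int fib_ratio_eq add_divide_distrib times_divide_eq_right)
qed

section \<open>Dependence on finitely many choices, and measurability\<close>

text \<open>The recursion reads only the choices 1 to \<open>n\<close>. This turns
  \<open>sel\<close>, \<open>dev\<close> and \<open>wdev\<close> into functions on a finite product
  space, the form in which independence of blocks of choices is applied.\<close>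

lemma sel_restrict: "n \<le> m \<Longrightarrow> sel (restrict c {1..m}) n = sel c n"
  by (induction n) (simp_all del: One_nat_def)

lemma dev_restrict: "n \<le> m \<Longrightarrow> dev p (restrict c {1..m}) n = dev p c n"
  by (simp add: dev_def sel_restrict del: One_nat_def)

lemma wdev_restrict: "n \<le> m \<Longrightarrow> wdev w p (restrict c {1..m}) n = wdev w p c n"
  unfolding wdev_def by (intro sum.cong refl) (simp add: dev_restrict del: One_nat_def)

text \<open>The abstract map \<open>c\<close> covers two cases: the random choices on the
  probability space, and the identity on the finite product space.\<close>

lemma measurable_sel:
  assumes "\<And>i. i \<in> {1..n} \<Longrightarrow> (\<lambda>x. c x i) \<in> measurable N (count_space UNIV)"
  shows "(\<lambda>x. sel (c x) n) \<in> borel_measurable N"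
  using assms
proof (induction n)
  case (Suc n)
  have [measurable]: "(\<lambda>x. sel (c x) n) \<in> borel_measurable N" using Suc by simp
  have [measurable]: "(\<lambda>x. c x (Suc n)) \<in> measurable N (count_space UNIV)" using Suc by simp
  show ?case by simp
qed simp

lemma measurable_dev:
  assumes "\<And>i. i \<in> {1..n} \<Longrightarrow> (\<lambda>x. c x i) \<in> measurable N (count_space UNIV)"
  shows "(\<lambda>x. dev p (c x) n) \<in> borel_measurable N"
  unfolding dev_def using measurable_sel[OF assms] by simp

lemma measurable_wdev:
  assumes "\<And>i. i \<in> {1..n} \<Longrightarrow> (\<lambda>x. c x i) \<in> measurable N (count_space UNIV)"
  shows "(\<lambda>x. wdev w p (c x) n) \<in> borel_measurable N"
  unfolding wdev_def using assms
  by (intro borel_measurable_sum borel_measurable_times measurable_dev) auto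

section \<open>The random choices, the linear recursion and its innovations\<close>

locale fib_choices = prob_space M for M :: "'a measure" +
  fixes X :: "nat \<Rightarrow> 'a \<Rightarrow> bool" and p :: real
  assumes p: "0 < p" "p < 1"
    and indep: "indep_vars (\<lambda>_. count_space UNIV) X {1..}"
    and prob_X: "n \<ge> 1 \<Longrightarrow> prob {\<omega> \<in> space M. X n \<omega>} = p"
begin

abbreviation choices :: "'a \<Rightarrow> nat \<Rightarrow> bool" where
  "choices \<omega> \<equiv> (\<lambda>i. X i \<omega>)"

lemma measurable_X: "n \<ge> 1 \<Longrightarrow> X n \<in> measurable M (count_space UNIV)"
  using indep by (auto simp: indep_vars_def)

lemma measurable_sel_choices [measurable]: "(\<lambda>\<omega>. sel (choices \<omega>) n) \<in> borel_measurable M"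
  by (rule measurable_sel) (simp add: measurable_X)

lemma measurable_dev_choices [measurable]: "(\<lambda>\<omega>. dev p (choices \<omega>) n) \<in> borel_measurable M"
  by (rule measurable_dev) (simp add: measurable_X)

lemma measurable_wdev_choices [measurable]:
  "(\<lambda>\<omega>. wdev w p (choices \<omega>) n) \<in> borel_measurable M"
  by (rule measurable_wdev) (simp add: measurable_X)

lemma abs_dev_le: "\<bar>dev p c n\<bar> \<le> 1"
proof -
  have "0 \<le> p / (1 + p)" "p / (1 + p) \<le> 1" using p by auto
  then show ?thesis using sel_01[of c n] unfolding dev_def by linarith
qed

text \<open>Split the choice as \<open>p\<close> plus its centred part. The first part contributes
  \<open>p * (1 - sel c n)\<close>, which is \<open>- p * dev p c n\<close> after subtracting the
  fixed point; the second part is the innovation.\<close>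

lemma dev_Suc:
  "dev p c (Suc n) = - p * dev p c n + (of_bool (c (Suc n)) - p) * (1 - sel c n)"
proof -
  have "p / (1 + p) = p - p * (p / (1 + p))" using p by (simp add: field_simps)
  then show ?thesis by (simp add: dev_def algebra_simps)
qed

text \<open>Choice \<open>Suc n\<close> is independent of the block of the first \<open>n\<close>
  choices and has mean \<open>p\<close>. The expectation of the product thus factors, and its second
  factor vanishes.\<close>

lemma innovation_orthogonal:
  fixes G :: "(nat \<Rightarrow> bool) \<Rightarrow> real"
  assumes meas: "G \<in> borel_measurable (PiM {1..n} (\<lambda>_. count_space UNIV))"
    and int: "integrable M (\<lambda>\<omega>. G (restrict (choices \<omega>) {1..n}))"
  shows "expectation (\<lambda>\<omega>. G (restrict (choices \<omega>) {1..n}) * (of_bool (X (Suc n) \<omega>) - p)) = 0"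
proof -
  let ?H = "\<lambda>c. of_bool (c (Suc n)) - p :: real"
  let ?N = "\<lambda>A. PiM A (\<lambda>_. count_space UNIV) :: (nat \<Rightarrow> bool) measure"
  have [measurable]: "(\<lambda>c. c (Suc n)) \<in> measurable (?N {Suc n}) (count_space UNIV)"
    by (rule measurable_component_singleton) simp
  have H: "?H \<in> borel_measurable (?N {Suc n})"
    by measurable
  have [measurable]: "X (Suc n) \<in> measurable M (count_space UNIV)"
    by (rule measurable_X) simp
  have intH: "integrable M (\<lambda>\<omega>. of_bool (X (Suc n) \<omega>) - p)"
    by (rule integrable_const_bound[where B = "1 + p"]) (use p in auto)
  have "expectation (\<lambda>\<omega>. of_bool (X (Suc n) \<omega>)) =
      expectation (indicator {\<omega> \<in> space M. X (Suc n) \<omega>})"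
    by (intro Bochner_Integration.integral_cong) (auto simp: indicator_def)
  also have "\<dots> = p"
    using prob_X[of "Suc n"] by simp
  finally have exp: "expectation (\<lambda>\<omega>. of_bool (X (Suc n) \<omega>)) = p" .
  have ind: "indep_var (?N {1..n}) (\<lambda>\<omega>. restrict (choices \<omega>) {1..n})
      (?N {Suc n}) (\<lambda>\<omega>. restrict (choices \<omega>) {Suc n})"
    by (rule indep_var_restrict[OF indep]) auto
  have "indep_var borel (\<lambda>\<omega>. G (restrict (choices \<omega>) {1..n})) borel
      (\<lambda>\<omega>. of_bool (X (Suc n) \<omega>) - p)"
    using indep_var_compose[OF ind meas H] by (simp add: comp_def)
  from indep_var_lebesgue_integral[OF this int intH]
  have "expectation (\<lambda>\<omega>. G (restrict (choices \<omega>) {1..n}) * (of_bool (X (Suc n) \<omega>) - p)) =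
      expectation (\<lambda>\<omega>. G (restrict (choices \<omega>) {1..n}))
        * expectation (\<lambda>\<omega>. of_bool (X (Suc n) \<omega>) - p)" .
  moreover have "integrable M (\<lambda>\<omega>. of_bool (X (Suc n) \<omega>) :: real)"
    by (rule integrable_const_bound[where B = 1]) auto
  ultimately show ?thesis
    using exp by (simp add: prob_space)
qed

section \<open>Second moments of the weighted sums\<close>

context
  fixes w :: "nat \<Rightarrow> real"
  assumes w: "\<And>i. \<bar>w i\<bar> \<le> 1"
begin

lemma abs_w_dev_le: "\<bar>w i * dev p c j\<bar> \<le> 1"
  using mult_mono[OF w[of i] abs_dev_le[of c j]] by (simp add: abs_mult)

lemma abs_wdev_le: "\<bar>wdev w p c n\<bar> \<le> real n"
proof (induction n)
  case (Suc n)
  then show ?case using abs_w_dev_le[of "Suc n" c "Suc n"] by (simp add: wdev_Suc)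
qed simp

lemma abs_wdev_mult_le: "\<bar>x\<bar> \<le> 1 \<Longrightarrow> \<bar>wdev w p c n * x\<bar> \<le> real n"
  using mult_mono[OF abs_wdev_le[of c n], of "\<bar>x\<bar>" 1] by (simp add: abs_mult)

lemma integrable_wdev_dev [simp]: "integrable M (\<lambda>\<omega>. wdev w p (choices \<omega>) n * dev p (choices \<omega>) m)"
  by (rule integrable_const_bound[where B = "real n"]) (simp_all add: abs_wdev_mult_le abs_dev_le)

lemma integrable_dev_sq [simp]: "integrable M (\<lambda>\<omega>. (dev p (choices \<omega>) m)\<^sup>2)"
  by (rule integrable_const_bound[where B = 1]) (simp_all add: abs_square_le_1 abs_dev_le)

lemma integrable_wdev_sq [simp]: "integrable M (\<lambda>\<omega>. (wdev w p (choices \<omega>) n)\<^sup>2)"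
proof (rule integrable_const_bound[where B = "(real n)\<^sup>2"])
  show "AE \<omega> in M. norm ((wdev w p (choices \<omega>) n)\<^sup>2) \<le> (real n)\<^sup>2"
    using abs_wdev_le by (intro AE_I2) (simp add: abs_le_square_iff[symmetric])
qed simp

text \<open>The factor \<open>\<bar>w i\<bar>\<close> makes this serve for the coefficient
  \<open>w i\<close>, and, after one more multiplication by \<open>\<bar>w i\<bar>\<close>, for its
  square.\<close>

lemma expectation_dev_sq_le: "\<bar>w i\<bar> * expectation (\<lambda>\<omega>. (dev p (choices \<omega>) n)\<^sup>2) \<le> 1"
proof -
  have "expectation (\<lambda>\<omega>. (dev p (choices \<omega>) n)\<^sup>2) \<le> expectation (\<lambda>_. 1)"
    by (intro integral_mono) (simp_all add: abs_square_le_1 abs_dev_le)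
  then show ?thesis
    using mult_mono[OF w[of i], of _ 1] by (simp add: prob_space)
qed

text \<open>Multiply \<open>dev_Suc\<close> by \<open>wdev w p c n\<close>. The innovation is then
  multiplied by a function of the first \<open>n\<close> choices, called \<open>?G\<close> below, so
  its expectation is 0.\<close>

lemma expectation_wdev_dev_Suc:
  "expectation (\<lambda>\<omega>. wdev w p (choices \<omega>) n * dev p (choices \<omega>) (Suc n)) =
     - p * expectation (\<lambda>\<omega>. wdev w p (choices \<omega>) n * dev p (choices \<omega>) n)"
proof -
  let ?G = "\<lambda>c. wdev w p c n * (1 - sel c n)"
  let ?N = "PiM {1..n} (\<lambda>_. count_space UNIV) :: (nat \<Rightarrow> bool) measure"
  have comp: "(\<lambda>c. c i) \<in> measurable ?N (count_space UNIV)" if "i \<in> {1..n}" for i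
    using that by (rule measurable_component_singleton)
  have meas: "?G \<in> borel_measurable ?N"
    by (intro borel_measurable_times borel_measurable_diff measurable_wdev measurable_sel comp) auto
  have G: "?G (restrict c {1..n}) = ?G c" for c
    by (simp add: wdev_restrict sel_restrict del: One_nat_def)
  have int: "integrable M (\<lambda>\<omega>. ?G (choices \<omega>))"
  proof (rule integrable_const_bound[where B = "real n"])
    have "\<bar>1 - sel c n\<bar> \<le> 1" for c using sel_01[of c n] by auto
    then show "AE \<omega> in M. norm (?G (choices \<omega>)) \<le> real n"
      by (simp add: abs_wdev_mult_le)
  qed simp
  have orth: "expectation (\<lambda>\<omega>. ?G (choices \<omega>) * (of_bool (X (Suc n) \<omega>) - p)) = 0"
    using innovation_orthogonal[OF meas] int by (simp only: G)
  have [measurable]: "X (Suc n) \<in> measurable M (count_space UNIV)"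
    by (rule measurable_X) simp
  have "integrable M (\<lambda>\<omega>. ?G (choices \<omega>) * (of_bool (X (Suc n) \<omega>) - p))"
  proof (rule Bochner_Integration.integrable_bound[OF int])
    \<comment> \<open>The centred choice is bounded by 1, so integrability is inherited from
      \<open>?G\<close>.\<close>
    have "\<bar>of_bool b - p\<bar> \<le> 1" for b using p by (cases b) auto
    then have "\<bar>x * (of_bool b - p)\<bar> \<le> \<bar>x\<bar>" for x b
      by (simp add: abs_mult mult_left_le)
    then show "AE \<omega> in M. norm (?G (choices \<omega>) * (of_bool (X (Suc n) \<omega>) - p))
        \<le> norm (?G (choices \<omega>))"
      by (simp only: real_norm_def AE_I2)
  qed simp
  moreover have "wdev w p c n * dev p c (Suc n) =
      - p * (wdev w p c n * dev p c n) + ?G c * (of_bool (c (Suc n)) - p)" for c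
    by (simp add: dev_Suc algebra_simps)
  ultimately show ?thesis
    using orth by simp
qed

text \<open>Adding the next summand changes the correlation by at most 1, and one step of the
  recursion multiplies it by \<open>- p\<close>. The bound \<open>p / (1 - p)\<close> is the fixed
  point of \<open>x = p * (x + 1)\<close>, hence is preserved.\<close>

lemma abs_expectation_wdev_dev_Suc_le:
  "\<bar>expectation (\<lambda>\<omega>. wdev w p (choices \<omega>) n * dev p (choices \<omega>) (Suc n))\<bar> \<le> p / (1 - p)"
proof (induction n)
  case 0
  then show ?case using p by simp
next
  case (Suc n)
  let ?K = "p / (1 - p)"
  let ?U = "\<lambda>m k. expectation (\<lambda>\<omega>. wdev w p (choices \<omega>) m * dev p (choices \<omega>) k)"
  let ?V = "expectation (\<lambda>\<omega>. (dev p (choices \<omega>) (Suc n))\<^sup>2)"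
  have "wdev w p c (Suc n) * dev p c (Suc n) =
      wdev w p c n * dev p c (Suc n) + w (Suc n) * (dev p c (Suc n))\<^sup>2" for c
    by (simp add: wdev_Suc algebra_simps power2_eq_square)
  then have "?U (Suc n) (Suc n) = ?U n (Suc n) + w (Suc n) * ?V"
    by simp
  moreover have "\<bar>w (Suc n) * ?V\<bar> \<le> 1"
    using expectation_dev_sq_le[of "Suc n" "Suc n"] by (simp add: abs_mult)
  ultimately have "\<bar>?U (Suc n) (Suc n)\<bar> \<le> ?K + 1"
    using Suc by linarith
  then have "p * \<bar>?U (Suc n) (Suc n)\<bar> \<le> p * (?K + 1)"
    using p by (intro mult_left_mono) auto
  also have "p * (?K + 1) = ?K"
    using p by (simp add: field_simps)
  finally show ?case
    using p by (simp add: expectation_wdev_dev_Suc abs_mult)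
qed

text \<open>Expanding the square, each new summand adds a cross term of at most
  \<open>2 * (p / (1 - p))\<close> and a square term of at most 1, which gives the constant.\<close>

lemma expectation_wdev_sq_le:
  "expectation (\<lambda>\<omega>. (wdev w p (choices \<omega>) n)\<^sup>2) \<le> (2 * (p / (1 - p)) + 1) * real n"
proof (induction n)
  case (Suc n)
  let ?U = "expectation (\<lambda>\<omega>. wdev w p (choices \<omega>) n * dev p (choices \<omega>) (Suc n))"
  let ?V = "expectation (\<lambda>\<omega>. (dev p (choices \<omega>) (Suc n))\<^sup>2)"
  have "(wdev w p c (Suc n))\<^sup>2 = (wdev w p c n)\<^sup>2
      + 2 * w (Suc n) * (wdev w p c n * dev p c (Suc n))
      + (w (Suc n))\<^sup>2 * (dev p c (Suc n))\<^sup>2" for c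
    by (simp add: wdev_Suc algebra_simps power2_eq_square)
  then have "expectation (\<lambda>\<omega>. (wdev w p (choices \<omega>) (Suc n))\<^sup>2) =
      expectation (\<lambda>\<omega>. (wdev w p (choices \<omega>) n)\<^sup>2) + 2 * w (Suc n) * ?U + (w (Suc n))\<^sup>2 * ?V"
    by simp
  moreover have "w (Suc n) * ?U \<le> p / (1 - p)"
    using mult_mono[OF w[of "Suc n"] abs_expectation_wdev_dev_Suc_le[of n]]
      abs_ge_self[of "w (Suc n) * ?U"]
    by (simp add: abs_mult)
  moreover have "(w (Suc n))\<^sup>2 * ?V \<le> 1"
    using mult_mono[OF w[of "Suc n"] expectation_dev_sq_le[of "Suc n" "Suc n"]]
    by (simp add: power2_eq_square mult.assoc[symmetric])
  moreover have "(2 * (p / (1 - p)) + 1) * real (Suc n) =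
      (2 * (p / (1 - p)) + 1) * real n + 2 * (p / (1 - p)) + 1"
    by (simp add: distrib_left)
  ultimately show ?case
    using Suc by linarith
qed simp

section \<open>Almost sure limits\<close>

text \<open>The second moment of \<open>wdev\<close> at \<open>n\<close>, divided by
  \<open>n^2\<close>, is only \<open>O(1/n)\<close>, which is not summable. Along
  \<open>n = k^2\<close> the bound becomes \<open>O(1/k^2)\<close>, and the gaps between squares are
  bridged by the bounded increments.\<close>

lemma AE_wdev_over_n: "AE \<omega> in M. (\<lambda>n. wdev w p (choices \<omega>) n / real n) \<longlonglongrightarrow> 0"
proof -
  let ?C = "2 * (p / (1 - p)) + 1"
  let ?f = "\<lambda>k \<omega>. (wdev w p (choices \<omega>) (k\<^sup>2) / real (k\<^sup>2))\<^sup>2"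
  have "AE \<omega> in M. (\<lambda>k. ?f k \<omega>) \<longlonglongrightarrow> 0"
  proof (rule AE_tendsto_0_of_summable_integral)
    show "integrable M (?f k)" for k
      by (simp add: power_divide del: of_nat_power)
    have "summable (\<lambda>k. ?C * inverse (real k ^ 2))"
      by (intro summable_mult inverse_power_summable) simp
    then show "summable (\<lambda>k. expectation (?f k))"
    proof (rule summable_comparison_test')
      fix k :: nat
      have "expectation (?f k) =
          expectation (\<lambda>\<omega>. (wdev w p (choices \<omega>) (k\<^sup>2))\<^sup>2) / (real (k\<^sup>2))\<^sup>2"
        by (simp add: power_divide del: of_nat_power)
      also have "\<dots> \<le> ?C * real (k\<^sup>2) / (real (k\<^sup>2))\<^sup>2"
        by (intro divide_right_mono expectation_wdev_sq_le) simp
      also have "\<dots> = ?C * (real (k\<^sup>2) / (real (k\<^sup>2))\<^sup>2)"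
        by (rule times_divide_eq_right[symmetric])
      \<comment> \<open>This includes \<open>k = 0\<close>, where both sides are 0 by the convention
        on division by zero.\<close>
      also have "real (k\<^sup>2) / (real (k\<^sup>2))\<^sup>2 = inverse (real k ^ 2)"
        by (simp add: power2_eq_square field_simps)
      finally show "norm (expectation (?f k)) \<le> ?C * inverse (real k ^ 2)"
        by simp
    qed
  qed simp
  then show ?thesis
  proof eventually_elim
    case (elim \<omega>)
    then have "(\<lambda>k. wdev w p (choices \<omega>) (k\<^sup>2) / real (k\<^sup>2)) \<longlonglongrightarrow> 0"
      by (simp only: power_tendsto_0_iff zero_less_numeral)
    then show ?case
      by (rule tendsto_0_of_squares[rotated]) (simp add: wdev_Suc abs_w_dev_le)
  qed
qed

end

text \<open>Stated for general \<open>S\<close> so as to give the numerator of the final ratio, and,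
  with \<open>UNIV\<close> for \<open>S\<close>, the denominator.\<close>

lemma AE_card_rand_fib_Int_over_n:
  assumes "fib_ratio S \<longlonglongrightarrow> q"
  shows "AE \<omega> in M. (\<lambda>n. real (card (rand_fib (choices \<omega>) n \<inter> S)) / real n)
    \<longlonglongrightarrow> p / (1 + p) * q"
proof -
  have "AE \<omega> in M. (\<lambda>n. wdev (\<lambda>i. of_bool (F i \<in> S)) p (choices \<omega>) n / real n) \<longlonglongrightarrow> 0"
    by (rule AE_wdev_over_n) simp
  then show ?thesis
  proof eventually_elim
    case (elim \<omega>)
    then have "(\<lambda>n. wdev (\<lambda>i. of_bool (F i \<in> S)) p (choices \<omega>) n / real n
        + p / (1 + p) * fib_ratio S n) \<longlonglongrightarrow> 0 + p / (1 + p) * q"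
      using assms by (intro tendsto_intros)
    then show ?case
      by (simp add: card_rand_fib_Int_div[of _ _ _ p])
  qed
qed

end

theorem theorem1p2:
  fixes M :: "'a measure" and X :: "nat \<Rightarrow> 'a \<Rightarrow> bool" and p :: real and S :: "nat set"
  assumes "0 < p" and "p < 1"
    and "prob_space M"
    and "prob_space.indep_vars M (\<lambda>_. count_space UNIV) X {1..}"
    and "\<And>n. n \<ge> 1 \<Longrightarrow> measure M {\<omega> \<in> space M. X n \<omega>} = p"
    and "S \<subseteq> F ` {1..}"
    and "convergent (fib_ratio S)"
  shows "AE \<omega> in M.
    (\<lambda>n. real (card (rand_fib (\<lambda>i. X i \<omega>) n \<inter> S)) / real (card (rand_fib (\<lambda>i. X i \<omega>) n)))
      \<longlonglongrightarrow> fib_density S"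
proof -
  interpret prob_space M by fact
  interpret fib_choices M X p
    using assms by unfold_locales auto
  have S: "fib_ratio S \<longlonglongrightarrow> fib_density S"
    using \<open>convergent (fib_ratio S)\<close> by (simp add: fib_density_def convergent_LIMSEQ_iff)
  have "\<forall>\<^sub>F n in sequentially. fib_ratio UNIV n = 1"
    using eventually_gt_at_top[of 0] by eventually_elim (simp add: fib_ratio_eq)
  then have "fib_ratio UNIV \<longlonglongrightarrow> 1"
    by (rule tendsto_eventually)
  from AE_card_rand_fib_Int_over_n[OF S] AE_card_rand_fib_Int_over_n[OF this]
  show ?thesis
  proof eventually_elim
    case (elim \<omega>)
    let ?A = "rand_fib (\<lambda>i. X i \<omega>)"
    \<comment> \<open>The quotient of limits is legitimate because the denominator tends to
      \<open>p / (1 + p)\<close>, which is positive.\<close>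
    have "(\<lambda>n. (real (card (?A n \<inter> S)) / real n) / (real (card (?A n \<inter> UNIV)) / real n))
        \<longlonglongrightarrow> (p / (1 + p) * fib_density S) / (p / (1 + p) * 1)"
      using elim \<open>0 < p\<close> by (intro tendsto_divide) auto
    moreover have "\<forall>\<^sub>F n in sequentially.
        (real (card (?A n \<inter> S)) / real n) / (real (card (?A n \<inter> UNIV)) / real n) =
        real (card (?A n \<inter> S)) / real (card (?A n))"
      using eventually_gt_at_top[of 0] by eventually_elim simp
    moreover have "(p / (1 + p) * fib_density S) / (p / (1 + p) * 1) = fib_density S"
      using \<open>0 < p\<close> by simp
    ultimately show ?case
      by (simp only: tendsto_cong)
  qed
qed

end
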